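(* Let $\alpha$ be a real number with $0\leq\alpha\leq 1$, and let $k\geq 2$ be an integer. Then there exists a subset $A$ of $\mathbb{N}$ such that for every integer $j$ with $1\leq j\leq k$, the set $jA$ has an asymptotic density and $$d(jA)=\frac{j\alpha}{k}.$$ In particular, $d(kA)=\alpha$.
   Context: $\mathbb{N}:=\{0,1,2,\dots\}$. For $A\subset\mathbb{N}$ and an integer $j\geq 1$, $jA:=\{x_1+\cdots+x_j : x_i\in A,\ i=1,\dots,j\}$ is the $j$-fold sumset (the $x_i$ are not required to be distinct; $1A=A$). For $X\subset\mathbb{N}$ and real $x\geq 1$, put $X(x):=|X\cap[1,x]|$ (the number of elements of $X$ in $[1,x]$), and $X(x):=0$ for $x<1$. The asymptotic (natural) density of $X$ is $dX=d(X):=\lim_{x\to+\infty} X(x)/x$, provided this limit exists; an equality $d(X)=c$ includes the assertion that the limit exists. *)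

theory Defs
  imports Complex_Main
begin

definition sumset :: "nat \<Rightarrow> nat set \<Rightarrow> nat set" where
  "sumset j A = {\<Sum>i=1..j. x i | x :: nat \<Rightarrow> nat. \<forall>i\<in>{1..j}. x i \<in> A}"

(* The element 0 is never counted, and the count is 0 for x < 1. *)
definition counting :: "nat set \<Rightarrow> real \<Rightarrow> nat" where
  "counting X x = card {n \<in> X. 1 \<le> n \<and> real n \<le> x}"

(* The density of X exists and equals d; the limit is over real x. *)
definition has_density :: "nat set \<Rightarrow> real \<Rightarrow> bool" where
  "has_density X d \<longleftrightarrow> ((\<lambda>x::real. real (counting X x) / x) \<longlongrightarrow> d) at_top"

end

(* With an irrational rotation number \<theta> let A be the Bohr set of all n with
   frac (n \<theta>) < \<beta>, where \<beta> = \<alpha> / k.  Adding fractional parts gives frac (n \<theta>) < j \<beta> for n in jA.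
   Conversely, since the fractional parts of the multiples of \<theta> are dense, every large n with
   frac (n \<theta>) well inside [0, j \<beta>) is reduced to the case of j - 1 summands by
   subtracting one of two fixed elements of A.  So jA has the density j \<beta> of the Bohr set of
   length j \<beta>.

   Equidistribution is obtained without exponential sums: if L = frac (m \<theta>), the
   indicator of frac (n \<theta>) < L is floor (n \<theta>) - floor ((n - m) \<theta>) - floor (m \<theta>), whose sum
   telescopes; other lengths are squeezed between lengths of this form. *)

theory Submission
  imports Defs "HOL-Analysis.Kronecker_Approximation_Theorem"
begin

section \<open>Counting and density\<close>

lemma finite_counting: "finite {n \<in> X. 1 \<le> n \<and> real n \<le> x}"
  by (rule finite_subset[of _ "{..nat \<lfloor>x\<rfloor>}"]) (auto simp: le_nat_floor)

lemma counting_mono: "X \<subseteq> Y \<Longrightarrow> counting X x \<le> counting Y x"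
  unfolding counting_def by (rule card_mono[OF finite_counting]) auto

lemma counting_Un_le: "counting (X \<union> Y) x \<le> counting X x + counting Y x"
proof -
  have "{n \<in> X \<union> Y. 1 \<le> n \<and> real n \<le> x} =
      {n \<in> X. 1 \<le> n \<and> real n \<le> x} \<union> {n \<in> Y. 1 \<le> n \<and> real n \<le> x}"
    by auto
  then show ?thesis
    by (simp only: counting_def card_Un_le)
qed

lemma counting_le_card: "finite X \<Longrightarrow> counting X x \<le> card X"
  unfolding counting_def by (rule card_mono) auto

lemma counting_eq_sum:
  assumes "x \<ge> 0"
  shows "real (counting X x) = (\<Sum>n=1..nat \<lfloor>x\<rfloor>. of_bool (n \<in> X))"
proof -
  have "{n \<in> X. 1 \<le> n \<and> real n \<le> x} = {1..nat \<lfloor>x\<rfloor>} \<inter> X"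
    using assms by (auto simp: le_nat_floor) linarith
  then show ?thesis
    by (simp add: counting_def sum.If_cases of_bool_def)
qed

lemma counting_le:
  assumes "x \<ge> 0"
  shows "real (counting X x) \<le> x"
proof -
  have "real (counting X x) \<le> (\<Sum>n=1..nat \<lfloor>x\<rfloor>. 1)"
    unfolding counting_eq_sum[OF assms] by (rule sum_mono) simp
  also have "\<dots> \<le> x"
    using assms by simp
  finally show ?thesis .
qed

text \<open>The two bounds are kept apart because for a sumset they come from different arguments:
  inclusion in a Bohr set above, a covering below.\<close>

lemma has_densityI:
  assumes upper: "\<And>\<epsilon>. \<epsilon> > 0 \<Longrightarrow> \<forall>\<^sub>F x in at_top. real (counting X x) \<le> (d + \<epsilon>) * x"
    and lower: "\<And>\<epsilon>. \<epsilon> > 0 \<Longrightarrow> \<forall>\<^sub>F x in at_top. (d - \<epsilon>) * x \<le> real (counting X x)"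
  shows "has_density X d"
  unfolding has_density_def
proof (rule tendstoI)
  fix \<epsilon> :: real assume "\<epsilon> > 0"
  then have "\<epsilon> / 2 > 0" by simp
  from upper[OF this] lower[OF this] eventually_gt_at_top[of 0]
  show "\<forall>\<^sub>F x in at_top. dist (real (counting X x) / x) d < \<epsilon>"
  proof eventually_elim
    case (elim x)
    then have "d - \<epsilon> / 2 \<le> real (counting X x) / x" "real (counting X x) / x \<le> d + \<epsilon> / 2"
      by (simp_all add: pos_le_divide_eq pos_divide_le_eq)
    then show ?case
      using \<open>\<epsilon> > 0\<close> unfolding dist_real_def by linarith
  qed
qed

section \<open>Bohr sets\<close>

text \<open>Times at which the rotation by \<open>\<theta>\<close>, started at 0, visits the arc [0,
  L) of the circle. No range is imposed on L: the set is empty for L \<le> 0 and everything for L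
  \<ge> 1.\<close>

definition bohr_set :: "real \<Rightarrow> real \<Rightarrow> nat set" where
  "bohr_set \<theta> L = {n. frac (real n * \<theta>) < L}"

text \<open>The difference \<open>frac x - frac y\<close> lies strictly between -1 and 1, so taking
  the floor of x - y borrows a unit exactly when it is negative.\<close>

lemma of_bool_frac_less_frac:
  fixes x y :: real
  shows "of_bool (frac x < frac y) = \<lfloor>x\<rfloor> - \<lfloor>x - y\<rfloor> - \<lfloor>y\<rfloor>"
proof (cases "frac x < frac y")
  case True
  then have "\<lfloor>x - y\<rfloor> = \<lfloor>x\<rfloor> - \<lfloor>y\<rfloor> - 1"
    using frac_lt_1[of y] frac_ge_0[of x] unfolding frac_def floor_eq_iff of_int_diff of_int_1
    by linarith
  with True show ?thesis by simp
next
  case False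
  then have "\<lfloor>x - y\<rfloor> = \<lfloor>x\<rfloor> - \<lfloor>y\<rfloor>"
    using frac_lt_1[of x] frac_ge_0[of y] unfolding frac_def floor_eq_iff of_int_diff
    by linarith
  with False show ?thesis by simp
qed

text \<open>Telescopes, since shifting by one further \<open>\<theta>\<close> replaces n by n -
  1.\<close>

lemma sum_floor_shift_one:
  fixes \<theta> c :: real
  shows "(\<Sum>n=1..N. \<lfloor>real n * \<theta> - c\<rfloor> - \<lfloor>real n * \<theta> - (c + \<theta>)\<rfloor>) = \<lfloor>real N * \<theta> - c\<rfloor> - \<lfloor>- c\<rfloor>"
proof (induction N)
  case (Suc N)
  have "\<lfloor>real (Suc N) * \<theta> - (c + \<theta>)\<rfloor> = \<lfloor>real N * \<theta> - c\<rfloor>"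
    by (rule arg_cong[of _ _ floor]) (simp add: algebra_simps)
  with Suc show ?case by (simp del: of_nat_Suc)
qed simp

text \<open>A shift by \<open>m * \<theta>\<close> is m successive shifts by
  \<open>\<theta>\<close>. Each telescopes to within 1 of \<open>N * \<theta>\<close>, so the error
  is at most m, uniformly in N.\<close>

lemma sum_floor_shift_bound:
  fixes \<theta> :: real
  shows "\<bar>real_of_int (\<Sum>n=1..N. \<lfloor>real n * \<theta>\<rfloor> - \<lfloor>real n * \<theta> - real m * \<theta>\<rfloor>)
    - real N * (real m * \<theta>)\<bar> \<le> real m"
proof (induction m)
  case (Suc m)
  define c where "c = real m * \<theta>"
  have c_Suc: "real (Suc m) * \<theta> = c + \<theta>"
    by (simp add: c_def algebra_simps)
  have "(\<Sum>n=1..N. \<lfloor>real n * \<theta>\<rfloor> - \<lfloor>real n * \<theta> - (c + \<theta>)\<rfloor>) =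
      (\<Sum>n=1..N. \<lfloor>real n * \<theta>\<rfloor> - \<lfloor>real n * \<theta> - c\<rfloor>) + (\<lfloor>real N * \<theta> - c\<rfloor> - \<lfloor>- c\<rfloor>)"
    unfolding sum_floor_shift_one[symmetric] sum.distrib[symmetric] by (rule sum.cong) auto
  moreover have "\<bar>real_of_int (\<lfloor>real N * \<theta> - c\<rfloor> - \<lfloor>- c\<rfloor>) - real N * \<theta>\<bar> \<le> 1"
    by linarith
  moreover have "real N * (c + \<theta>) = real N * c + real N * \<theta>"
    by (simp add: algebra_simps)
  ultimately show ?case
    using Suc unfolding c_Suc c_def[symmetric] by simp
qed simp

text \<open>For these special lengths the discrepancy stays bounded as x grows: m comes from the
  telescoped floors, and 1 from replacing the integer part of x by x.\<close>

lemma counting_bohr_set_frac: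
  fixes \<theta> x :: real and m :: nat
  assumes "x \<ge> 0"
  defines "L \<equiv> frac (real m * \<theta>)"
  shows "\<bar>real (counting (bohr_set \<theta> L) x) - L * x\<bar> \<le> real m + 1"
proof -
  define N where "N = nat \<lfloor>x\<rfloor>"
  have "real (counting (bohr_set \<theta> L) x) = real_of_int (\<Sum>n=1..N. of_bool (frac (real n * \<theta>) < L))"
    unfolding counting_eq_sum[OF assms(1)] N_def[symmetric] of_int_sum by (simp add: bohr_set_def)
  also have "\<dots> = real_of_int (\<Sum>n=1..N. \<lfloor>real n * \<theta>\<rfloor> - \<lfloor>real n * \<theta> - real m * \<theta>\<rfloor>)
      - real N * \<lfloor>real m * \<theta>\<rfloor>"
    unfolding L_def of_bool_frac_less_frac by (simp add: sum_subtractf)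
  finally have count: "real (counting (bohr_set \<theta> L) x) =
    real_of_int (\<Sum>n=1..N. \<lfloor>real n * \<theta>\<rfloor> - \<lfloor>real n * \<theta> - real m * \<theta>\<rfloor>) - real N * \<lfloor>real m * \<theta>\<rfloor>" .
  have "real N * L = real N * (real m * \<theta>) - real N * \<lfloor>real m * \<theta>\<rfloor>"
    by (simp add: L_def frac_def algebra_simps)
  then have "\<bar>real (counting (bohr_set \<theta> L) x) - real N * L\<bar> \<le> real m"
    using sum_floor_shift_bound[where N=N and m=m and \<theta>=\<theta>] unfolding count by linarith
  moreover have "\<bar>real N * L - L * x\<bar> \<le> 1"
  proof -
    have "\<bar>real N - x\<bar> \<le> 1"
      using assms(1) unfolding N_def by linarith
    moreover have "\<bar>L\<bar> \<le> 1"
      using frac_lt_1[of "real m * \<theta>"] frac_ge_0[of "real m * \<theta>"] unfolding L_def by linarith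
    ultimately have "\<bar>L\<bar> * \<bar>real N - x\<bar> \<le> 1"
      by (simp add: mult_le_one)
    then show ?thesis
      by (simp add: abs_mult[symmetric] algebra_simps)
  qed
  ultimately show ?thesis by linarith
qed

lemma bohr_set_mono: "L \<le> M \<Longrightarrow> bohr_set \<theta> L \<subseteq> bohr_set \<theta> M"
  by (auto simp: bohr_set_def)

lemma eventually_le_linear:
  fixes c \<epsilon> :: real
  assumes "\<epsilon> > 0"
  shows "\<forall>\<^sub>F x in at_top. c \<le> \<epsilon> * x"
  using eventually_ge_at_top[of "c / \<epsilon>"]
  by eventually_elim (use assms in \<open>simp add: pos_divide_le_eq mult.commute\<close>)

text \<open>Enlarge the arc to a length \<open>frac (m * \<theta>)\<close> with bounded discrepancy;
  m depends only on L and \<epsilon>, so \<open>m + 1\<close> is eventually absorbed.\<close>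

lemma bohr_set_upper:
  assumes "\<theta> \<notin> \<rat>" "0 \<le> L" "\<epsilon> > 0"
  shows "\<forall>\<^sub>F x in at_top. real (counting (bohr_set \<theta> L) x) \<le> (L + \<epsilon>) * x"
\<comment> \<open>Kronecker's theorem needs a target in [0, 1]; when L + \<epsilon> reaches 1, the
  trivial count of at most x suffices.\<close>
proof (cases "L + \<epsilon> \<ge> 1")
  case True
  show ?thesis
    using eventually_ge_at_top[of 0]
  proof eventually_elim
    case (elim x)
    then show ?case
      using counting_le[OF elim, of "bohr_set \<theta> L"] mult_right_mono[OF True elim] by simp
  qed
next
  case False
  \<comment> \<open>Target and tolerance \<epsilon> / 3 put the new length between L and L +
    2\<epsilon>/3, leaving \<epsilon> / 3 for the discrepancy.\<close>
  obtain m where m: "\<bar>frac (real m * \<theta>) - (L + \<epsilon> / 3)\<bar> < \<epsilon> / 3"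
    using assms False by (elim Kronecker_approx_1_explicit[of \<theta> "L + \<epsilon> / 3" "\<epsilon> / 3"]) auto
  define M where "M = frac (real m * \<theta>)"
  have M: "L \<le> M" "M \<le> L + 2 * \<epsilon> / 3"
    using m unfolding M_def by linarith+
  have "\<forall>\<^sub>F x in at_top. real m + 1 \<le> \<epsilon> / 3 * x"
    using assms by (intro eventually_le_linear) simp
  then show ?thesis
    using eventually_ge_at_top[of 0]
  proof eventually_elim
    case (elim x)
    have "real (counting (bohr_set \<theta> L) x) \<le> real (counting (bohr_set \<theta> M) x)"
      using counting_mono[OF bohr_set_mono[OF M(1)]] by simp
    also have "\<dots> \<le> M * x + (real m + 1)"
      using counting_bohr_set_frac[OF elim(2), of \<theta> m] unfolding M_def by linarith
    also have "\<dots> \<le> (L + 2 * \<epsilon> / 3) * x + \<epsilon> / 3 * x"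
      by (intro add_mono mult_right_mono M elim)
    also have "\<dots> = (L + \<epsilon>) * x"
      by (simp add: algebra_simps)
    finally show ?case .
  qed
qed

text \<open>Mirror image of the upper bound: the arc is shrunk to a length of the special form, and
  the trivial case is a nonpositive left side.\<close>

lemma bohr_set_lower:
  assumes "\<theta> \<notin> \<rat>" "L \<le> 1" "\<epsilon> > 0"
  shows "\<forall>\<^sub>F x in at_top. (L - \<epsilon>) * x \<le> real (counting (bohr_set \<theta> L) x)"
proof (cases "L - \<epsilon> \<le> 0")
  case True
  show ?thesis
    using eventually_ge_at_top[of 0]
  proof eventually_elim
    case (elim x)
    then show ?case
      using mult_nonpos_nonneg[OF True elim] by linarith
  qed
next
  case False
  obtain m where m: "\<bar>frac (real m * \<theta>) - (L - \<epsilon> / 3)\<bar> < \<epsilon> / 3"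
    using assms False by (elim Kronecker_approx_1_explicit[of \<theta> "L - \<epsilon> / 3" "\<epsilon> / 3"]) auto
  define M where "M = frac (real m * \<theta>)"
  have M: "M \<le> L" "L - 2 * \<epsilon> / 3 \<le> M"
    using m unfolding M_def by linarith+
  have "\<forall>\<^sub>F x in at_top. real m + 1 \<le> \<epsilon> / 3 * x"
    using assms by (intro eventually_le_linear) simp
  then show ?thesis
    using eventually_ge_at_top[of 0]
  proof eventually_elim
    case (elim x)
    have "(L - \<epsilon>) * x = (L - 2 * \<epsilon> / 3) * x - \<epsilon> / 3 * x"
      by (simp add: algebra_simps)
    also have "\<dots> \<le> M * x - (real m + 1)"
      by (intro diff_mono mult_right_mono M elim)
    also have "\<dots> \<le> real (counting (bohr_set \<theta> M) x)"
      using counting_bohr_set_frac[OF elim(2), of \<theta> m] unfolding M_def by linarith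
    also have "\<dots> \<le> real (counting (bohr_set \<theta> L) x)"
      using counting_mono[OF bohr_set_mono[OF M(1)]] by simp
    finally show ?case .
  qed
qed

section \<open>Sumsets of Bohr sets\<close>

lemma sumset_1: "sumset 1 A = A"
proof -
  have "n \<in> sumset 1 A" if "n \<in> A" for n
    unfolding sumset_def using that by (auto intro!: exI[of _ "\<lambda>_. n"])
  then show ?thesis
    by (auto simp: sumset_def)
qed

lemma sumset_SucI:
  assumes "a \<in> sumset j A" "b \<in> A"
  shows "a + b \<in> sumset (Suc j) A"
proof -
  obtain x where x: "a = (\<Sum>i=1..j. x i)" "\<forall>i\<in>{1..j}. x i \<in> A"
    using assms(1) by (auto simp: sumset_def)
  define y where "y = x(Suc j := b)"
  have "(\<Sum>i=1..j. y i) = (\<Sum>i=1..j. x i)"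
    by (rule sum.cong) (auto simp: y_def)
  then have "a + b = (\<Sum>i=1..Suc j. y i)"
    by (simp add: x y_def)
  moreover have "\<forall>i\<in>{1..Suc j}. y i \<in> A"
    using x(2) assms(2) by (auto simp: y_def)
  ultimately show ?thesis
    unfolding sumset_def by blast
qed

lemma frac_add_le: "frac (x + y) \<le> frac x + frac (y :: real)"
  by (simp add: frac_add)

lemma frac_sum_le:
  fixes f :: "'a \<Rightarrow> real"
  shows "frac (sum f S) \<le> (\<Sum>i\<in>S. frac (f i))"
proof (induction S rule: infinite_finite_induct)
  case (insert i S)
  then show ?case
    using frac_add_le[of "f i" "sum f S"] by simp
qed auto

text \<open>Fractional parts are subadditive. At least one summand is required for strictness: the
  empty sum 0 is not in the empty set \<open>bohr_set \<theta> 0\<close>.\<close>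

lemma sumset_bohr_set_subset:
  assumes "j \<ge> 1"
  shows "sumset j (bohr_set \<theta> \<beta>) \<subseteq> bohr_set \<theta> (real j * \<beta>)"
proof
  fix n assume "n \<in> sumset j (bohr_set \<theta> \<beta>)"
  then obtain x where n: "n = (\<Sum>i=1..j. x i)"
    and x: "\<And>i. i \<in> {1..j} \<Longrightarrow> frac (real (x i) * \<theta>) < \<beta>"
    by (auto simp: sumset_def bohr_set_def)
  have "frac (real n * \<theta>) \<le> (\<Sum>i=1..j. frac (real (x i) * \<theta>))"
    using frac_sum_le[of "\<lambda>i. real (x i) * \<theta>" "{1..j}"] by (simp add: n sum_distrib_right)
  also have "\<dots> < (\<Sum>i=1..j. \<beta>)"
    by (rule sum_strict_mono) (use assms x in auto)
  finally show "n \<in> bohr_set \<theta> (real j * \<beta>)"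
    by (simp add: bohr_set_def)
qed

text \<open>Converse inclusion, with a margin \<epsilon> trimmed from both ends of the arc and
  finitely many n excluded. The induction lets \<epsilon> vary, since removing a summand costs part
  of the margin.\<close>

lemma sumset_bohr_set_supset:
  assumes "\<theta> \<notin> \<rat>" "0 < \<beta>" "\<beta> \<le> 1" "j \<ge> 1" "\<epsilon> > 0"
  shows "\<exists>n0. \<forall>n\<ge>n0. \<epsilon> \<le> frac (real n * \<theta>) \<longrightarrow> frac (real n * \<theta>) < real j * \<beta> - \<epsilon>
    \<longrightarrow> n \<in> sumset j (bohr_set \<theta> \<beta>)"
  using assms(4,5)
proof (induction j arbitrary: \<epsilon> rule: nat_induct_at_least)
  case base
  then have "frac (real n * \<theta>) < real 1 * \<beta> - \<epsilon> \<Longrightarrow> n \<in> sumset 1 (bohr_set \<theta> \<beta>)" for n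
    unfolding sumset_1 bohr_set_def by simp
  then show ?case by blast
next
  case (Suc j)
  \<comment> \<open>A third of the margin suffices: below, p has fractional part in (\<delta>,
    2\<delta>) and q in (\<beta> - 2\<delta>, \<beta> - \<delta>), so both lie in the Bohr set and
    subtracting the suitable one leaves a margin \<delta>.\<close>
  define \<delta> where "\<delta> = min \<epsilon> \<beta> / 3"
  have \<delta>: "0 < \<delta>" "3 * \<delta> \<le> \<epsilon>" "3 * \<delta> \<le> \<beta>"
    using Suc.prems assms(2) by (auto simp: \<delta>_def)
  obtain n0 where n0: "\<And>n. n \<ge> n0 \<Longrightarrow> \<delta> \<le> frac (real n * \<theta>) \<Longrightarrow> frac (real n * \<theta>) < real j * \<beta> - \<delta>
      \<Longrightarrow> n \<in> sumset j (bohr_set \<theta> \<beta>)"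
    using Suc.IH[OF \<delta>(1)] by blast
  obtain p where p: "\<bar>frac (real p * \<theta>) - 3 / 2 * \<delta>\<bar> < \<delta> / 2"
    using assms \<delta> by (elim Kronecker_approx_1_explicit[of \<theta> "3 / 2 * \<delta>" "\<delta> / 2"]) auto
  obtain q where q: "\<bar>frac (real q * \<theta>) - (\<beta> - 3 / 2 * \<delta>)\<bar> < \<delta> / 2"
    using assms \<delta> by (elim Kronecker_approx_1_explicit[of \<theta> "\<beta> - 3 / 2 * \<delta>" "\<delta> / 2"]) auto
  have j: "\<beta> \<le> real j * \<beta>"
    using Suc.hyps assms(2) by simp
  show ?case
  \<comment> \<open>This threshold keeps n - r above \<open>n0\<close> whether r is p or q.\<close>
  proof (intro exI[of _ "n0 + p + q"] allI impI)
    fix n assume n: "n \<ge> n0 + p + q" "\<epsilon> \<le> frac (real n * \<theta>)" "frac (real n * \<theta>) < real (Suc j) * \<beta> - \<epsilon>"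
    have Suc_eq: "real (Suc j) * \<beta> = real j * \<beta> + \<beta>"
      by (simp add: algebra_simps)
    obtain r where r: "frac (real r * \<theta>) < \<beta>" "\<delta> \<le> frac (real n * \<theta>) - frac (real r * \<theta>)"
        "frac (real n * \<theta>) - frac (real r * \<theta>) < real j * \<beta> - \<delta>" "r \<le> p + q"
    \<comment> \<open>If the point already lies in the arc for j summands, the small step p moves it
      off the upper end; otherwise the step q of nearly \<beta> brings it back into that
      arc.\<close>
    proof (cases "frac (real n * \<theta>) < real j * \<beta>")
      case True
      show ?thesis
        by (rule that[of p]) (use True n(2) p \<delta> in linarith)+
    next
      case False
      show ?thesis
        by (rule that[of q]) (use False n(3)[unfolded Suc_eq] q \<delta> j in linarith)+
    qed
    have "r \<le> n" "n - r \<ge> n0"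
      using n(1) r(4) by linarith+
    \<comment> \<open>The difference of fractional parts is positive, so subtraction does not wrap
      around the circle.\<close>
    have "frac (real (n - r) * \<theta>) = frac (real n * \<theta>) - frac (real r * \<theta>)"
      using \<open>r \<le> n\<close> r(2) \<delta>(1) by (simp add: of_nat_diff left_diff_distrib frac_diff_pos)
    with r(2,3) have "n - r \<in> sumset j (bohr_set \<theta> \<beta>)"
      by (intro n0 \<open>n - r \<ge> n0\<close>) auto
    moreover have "r \<in> bohr_set \<theta> \<beta>"
      using r(1) by (simp add: bohr_set_def)
    ultimately show "n \<in> sumset (Suc j) (bohr_set \<theta> \<beta>)"
      using sumset_SucI[of "n - r" j _ r] \<open>r \<le> n\<close> by simp
  qed
qed

text \<open>A slightly shorter arc is covered by the sumset, a short arc at 0 and a finite initial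
  segment; the last two have arbitrarily small density.\<close>

lemma sumset_bohr_set_lower:
  assumes "\<theta> \<notin> \<rat>" "0 < \<beta>" "real j * \<beta> \<le> 1" "j \<ge> 1" "\<epsilon> > 0"
  shows "\<forall>\<^sub>F x in at_top. (real j * \<beta> - \<epsilon>) * x \<le> real (counting (sumset j (bohr_set \<theta> \<beta>)) x)"
proof -
  \<comment> \<open>Five losses of \<delta>: one for trimming the upper end, one for counting the
    long arc, two for counting the short arc, one for the initial segment.\<close>
  define \<delta> where "\<delta> = \<epsilon> / 5"
  define S where "S = sumset j (bohr_set \<theta> \<beta>)"
  have "\<delta> > 0" using assms by (simp add: \<delta>_def)
  have "\<beta> \<le> real j * \<beta>" using assms by simp
  then have "\<beta> \<le> 1" using assms(3) by linarith
  obtain n0 where n0: "\<And>n. n \<ge> n0 \<Longrightarrow> \<delta> \<le> frac (real n * \<theta>) \<Longrightarrow> frac (real n * \<theta>) < real j * \<beta> - \<delta>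
      \<Longrightarrow> n \<in> S"
    using sumset_bohr_set_supset[OF assms(1,2) \<open>\<beta> \<le> 1\<close> assms(4) \<open>\<delta> > 0\<close>] unfolding S_def by blast
  have sub: "bohr_set \<theta> (real j * \<beta> - \<delta>) \<subseteq> S \<union> (bohr_set \<theta> \<delta> \<union> {..<n0})"
  proof
    fix n assume "n \<in> bohr_set \<theta> (real j * \<beta> - \<delta>)"
    then show "n \<in> S \<union> (bohr_set \<theta> \<delta> \<union> {..<n0})"
      using n0[of n] by (cases "n \<ge> n0"; cases "\<delta> \<le> frac (real n * \<theta>)") (simp_all add: bohr_set_def)
  qed
  have "\<forall>\<^sub>F x in at_top. (real j * \<beta> - \<delta> - \<delta>) * x \<le> real (counting (bohr_set \<theta> (real j * \<beta> - \<delta>)) x)"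
    using assms \<open>\<delta> > 0\<close> by (intro bohr_set_lower) auto
  moreover have "\<forall>\<^sub>F x in at_top. real (counting (bohr_set \<theta> \<delta>) x) \<le> (\<delta> + \<delta>) * x"
    using assms \<open>\<delta> > 0\<close> by (intro bohr_set_upper) auto
  moreover have "\<forall>\<^sub>F x in at_top. real n0 \<le> \<delta> * x"
    using \<open>\<delta> > 0\<close> by (rule eventually_le_linear)
  ultimately show ?thesis
    unfolding S_def[symmetric]
  proof eventually_elim
    case (elim x)
    have "counting (bohr_set \<theta> (real j * \<beta> - \<delta>)) x \<le> counting S x + (counting (bohr_set \<theta> \<delta>) x + n0)"
      using counting_mono[OF sub, of x] counting_Un_le[of S "bohr_set \<theta> \<delta> \<union> {..<n0}" x]
        counting_Un_le[of "bohr_set \<theta> \<delta>" "{..<n0}" x] counting_le_card[of "{..<n0}" x] by simp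
    moreover have "(real j * \<beta> - \<epsilon>) * x = (real j * \<beta> - \<delta> - \<delta>) * x - (\<delta> + \<delta>) * x - \<delta> * x"
      by (simp add: \<delta>_def algebra_simps)
    ultimately show ?case
      using elim by linarith
  qed
qed

lemma has_density_sumset_bohr_set:
  assumes "\<theta> \<notin> \<rat>" "0 \<le> \<beta>" "real j * \<beta> \<le> 1" "j \<ge> 1"
  shows "has_density (sumset j (bohr_set \<theta> \<beta>)) (real j * \<beta>)"
proof (rule has_densityI)
  fix \<epsilon> :: real assume "\<epsilon> > 0"
  have "\<forall>\<^sub>F x in at_top. real (counting (bohr_set \<theta> (real j * \<beta>)) x) \<le> (real j * \<beta> + \<epsilon>) * x"
    using assms \<open>\<epsilon> > 0\<close> by (intro bohr_set_upper) auto
  then show "\<forall>\<^sub>F x in at_top. real (counting (sumset j (bohr_set \<theta> \<beta>)) x) \<le> (real j * \<beta> + \<epsilon>) * x"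
  proof eventually_elim
    case (elim x)
    then show ?case
      using counting_mono[OF sumset_bohr_set_subset[OF assms(4)], of \<theta> \<beta> x] by linarith
  qed
  show "\<forall>\<^sub>F x in at_top. (real j * \<beta> - \<epsilon>) * x \<le> real (counting (sumset j (bohr_set \<theta> \<beta>)) x)"
  \<comment> \<open>The covering argument subtracts elements of the Bohr set and so needs an arc of
    positive length; for \<beta> = 0 the bound to be shown is nonpositive.\<close>
  proof (cases "\<beta> = 0")
    case True
    show ?thesis
      using eventually_ge_at_top[of 0]
    proof eventually_elim
      case (elim x)
      then have "(real j * \<beta> - \<epsilon>) * x \<le> 0"
        using True \<open>\<epsilon> > 0\<close> by simp
      then show ?case by linarith
    qed
  next
    case False
    then show ?thesis
      using assms \<open>\<epsilon> > 0\<close> by (intro sumset_bohr_set_lower) auto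
  qed
qed

theorem theorem1p3:
  fixes \<alpha> :: real and k :: nat
  assumes "0 \<le> \<alpha>" and "\<alpha> \<le> 1" and "k \<ge> 2"
  shows "\<exists>A :: nat set.
    (\<forall>j::nat. 1 \<le> j \<and> j \<le> k \<longrightarrow> has_density (sumset j A) (real j * \<alpha> / real k)) \<and>
    has_density (sumset k A) \<alpha>"
proof -
  have "(\<rat> :: real set) \<noteq> UNIV"
    using uncountable_UNIV_real countable_rat by metis
  then obtain \<theta> :: real where \<theta>: "\<theta> \<notin> \<rat>"
    by blast
  have dens: "has_density (sumset j (bohr_set \<theta> (\<alpha> / real k))) (real j * \<alpha> / real k)"
    if j: "1 \<le> j" "j \<le> k" for j
  proof -
    \<comment> \<open>Since j \<le> k and \<alpha> \<le> 1, the arc for j summands has length at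
      most 1 and does not overlap itself, so its length is the density.\<close>
    have "real j * (\<alpha> / real k) \<le> real k * (\<alpha> / real k)"
      using j assms by (intro mult_right_mono) auto
    also have "\<dots> \<le> 1"
      using assms by simp
    finally show ?thesis
      using has_density_sumset_bohr_set[OF \<theta>, of "\<alpha> / real k" j] j assms by simp
  qed
  moreover have "has_density (sumset k (bohr_set \<theta> (\<alpha> / real k))) \<alpha>"
    using dens[of k] assms by simp
  ultimately show ?thesis
    by blast
qed

end
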